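(* For every $\epsilon>0$ there is a number $C=C(\epsilon)$, depending only on $\epsilon$, such that the following holds. Let $G$ be a finite group having a subgroup $K$ such that $Pr(K,G)\geq\epsilon$. Then there is a normal subgroup $T$ of $G$ and a subgroup $B\leq K$ such that the index $[G:T]$, the index $[K:B]$, and the order of the commutator subgroup $[T,B]$ are all at most $C$.
   Context: For a subgroup $K$ of a finite group $G$, $$Pr(K,G)=\frac{|\{(x,y)\in K\times G : xy=yx\}|}{|K||G|}.$$ For subgroups $T,B$ of $G$, $[T,B]$ is the subgroup generated by all commutators $[t,b]$ with $t\in T$, $b\in B$. *)

theory Defs
  imports Complex_Main "HOL-Algebra.Generated_Groups"
begin

definition commuting_prob :: "('a, 'b) monoid_scheme \<Rightarrow> 'a set \<Rightarrow> real" where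
  "commuting_prob G K =
     real (card {(x, y). x \<in> K \<and> y \<in> carrier G \<and> x \<otimes>\<^bsub>G\<^esub> y = y \<otimes>\<^bsub>G\<^esub> x})
       / (real (card K) * real (order G))"

text \<open>The commutators are formed as in \<^const>\<open>derived\<close>. For subgroups T and B, the convention
  with the inverses on the left generates the same subgroup.\<close>

definition commutator_subgroup :: "('a, 'b) monoid_scheme \<Rightarrow> 'a set \<Rightarrow> 'a set \<Rightarrow> 'a set" where
  "commutator_subgroup G T B =
     generate G (\<Union>t \<in> T. \<Union>b \<in> B. {t \<otimes>\<^bsub>G\<^esub> b \<otimes>\<^bsub>G\<^esub> inv\<^bsub>G\<^esub> t \<otimes>\<^bsub>G\<^esub> inv\<^bsub>G\<^esub> b})"

text \<open>The index [H : L] of a subgroup L of G contained in the subgroup H of G.\<close>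

definition subgroup_index :: "('a, 'b) monoid_scheme \<Rightarrow> 'a set \<Rightarrow> 'a set \<Rightarrow> nat" where
  "subgroup_index G H L = card (rcosets\<^bsub>G\<lparr>carrier := H\<rparr>\<^esub> L)"

end

theory Submission
  imports Defs
begin

text \<open>If \<open>Pr(K,G) \<ge> \<epsilon>\<close>, then a positive proportion of the elements of \<open>K\<close> have boundedly many
  conjugates in \<open>G\<close>, and a positive proportion of the elements of \<open>G\<close> have boundedly many conjugates
  under \<open>K\<close>. As the number of conjugates is submultiplicative, relaxing the bound step by step
  produces subgroups \<open>B \<le> K\<close> and \<open>T \<le> G\<close> of bounded index all of whose elements have boundedly
  many conjugates under \<open>G\<close> and under \<open>K\<close>.

  Choose \<open>a \<in> B\<close> with the largest number of conjugates under \<open>T\<close>, and let \<open>U\<close> be the centralizer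
  in \<open>B\<close> of elements of \<open>T\<close> realising these conjugates. By an argument of Neumann, all commutators
  \<open>[t,u]\<close> with \<open>t \<in> T\<close> and \<open>u \<in> U\<close> lie in the bounded set \<open>S\<close> of the \<open>d\<^sup>-\<^sup>1 c\<close> with \<open>c\<close>, \<open>d\<close> conjugates
  of \<open>a\<close>. The normal core \<open>N\<close> of the centralizer of \<open>a\<close> in \<open>T\<close> centralizes \<open>S\<close>. So for each \<open>u \<in> U\<close>
  the commutators \<open>[t,u]\<close> with \<open>t \<in> N\<close> form a central subgroup of \<open>N\<close> inside \<open>S\<close>, and \<open>[N,U]\<close> is a
  product of boundedly many of these.\<close>

section \<open>Counting conjugates and cosets\<close>

text \<open>The orbit of \<open>x\<close> under conjugation by \<open>H\<close>. Since
  \<open>x\<close> need not lie in \<open>H\<close>, this also covers elements of \<open>G\<close>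
  conjugated by \<open>K\<close>.\<close>

definition conjugates :: "('a, 'b) monoid_scheme \<Rightarrow> 'a set \<Rightarrow> 'a \<Rightarrow> 'a set" where
  "conjugates G H x = (\<lambda>h. h \<otimes>\<^bsub>G\<^esub> x \<otimes>\<^bsub>G\<^esub> inv\<^bsub>G\<^esub> h) ` H"

text \<open>On \<open>A\<close> the map \<open>g\<close> factors through \<open>f\<close>, so it
  takes at most as many values as \<open>f\<close>.\<close>

lemma card_image_le_card_fibres:
  assumes "finite F" "f ` A \<subseteq> F" "\<And>x y. \<lbrakk>x \<in> A; y \<in> A; f x = f y\<rbrakk> \<Longrightarrow> g x = g y"
  shows "card (g ` A) \<le> card F"
proof -
  have "g ` A = (\<lambda>c. g (inv_into A f c)) ` (f ` A)"
  proof -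
    have "g x = g (inv_into A f (f x))" if "x \<in> A" for x
      using assms(3) that by (metis f_inv_into_f imageI inv_into_into)
    then show ?thesis by (auto simp: image_image)
  qed
  then show ?thesis
    by (metis assms(1,2) card_image_le card_mono finite_subset order_trans)
qed

lemma conjugates_finite: "finite H \<Longrightarrow> finite (conjugates G H x)"
  by (simp add: conjugates_def)

context group
begin

lemma subgroup_index_alt:
  "subgroup_index G H L = card ((\<lambda>x. L #> x) ` H)"
  by (simp add: subgroup_index_def RCOSETS_def r_coset_def UNION_singleton_eq_range)

lemma subgroup_index_mult_card:
  assumes "subgroup H G" "subgroup L G" "L \<subseteq> H"
  shows "subgroup_index G H L * card L = card H"
proof -
  interpret H: group "G\<lparr>carrier := H\<rparr>"
    using assms(1) subgroup_imp_group by blast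
  have "subgroup L (G\<lparr>carrier := H\<rparr>)"
    using assms subgroup_incl by blast
  from H.lagrange[OF this] show ?thesis
    by (simp add: subgroup_index_def order_def mult.commute)
qed

text \<open>Elements with equal \<open>f\<close>-value lie in one right coset of \<open>L\<close>,
  so there are at most as many cosets as values. The index bounds for normal cores and centralizers
  come from suitable choices of \<open>f\<close>.\<close>

lemma subgroup_index_le_fibres:
  assumes "subgroup H G" "subgroup L G" "finite F" "f ` H \<subseteq> F"
    and "\<And>x y. \<lbrakk>x \<in> H; y \<in> H; f x = f y\<rbrakk> \<Longrightarrow> x \<otimes> inv y \<in> L"
  shows "subgroup_index G H L \<le> card F"
  unfolding subgroup_index_alt
proof (rule card_image_le_card_fibres[OF assms(3,4)])
  fix x y assume xy: "x \<in> H" "y \<in> H" "f x = f y"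
  then have carr: "x \<in> carrier G" "y \<in> carrier G"
    using subgroup.mem_carrier[OF assms(1)] by auto
  then have "L #> (x \<otimes> inv y) = L"
    using xy by (intro coset_join2 assms(2,5)) auto
  then show "L #> x = L #> y"
    using carr subgroup.subset[OF assms(2)] by (intro coset_mult_inv1)
qed

lemma mult_inv_cancel [simp]:
  assumes "x \<in> carrier G" "y \<in> carrier G"
  shows "inv x \<otimes> (x \<otimes> y) = y" "x \<otimes> (inv x \<otimes> y) = y"
  using assms by (simp_all add: m_assoc [symmetric])

text \<open>Conjugating by \<open>inv x\<close> instead of \<open>x\<close> produces
  \<open>x \<otimes> inv y\<close>, the form that \<open>subgroup_index_le_fibres\<close> asks
  for.\<close>

lemma inv_conj_eq_commute:
  assumes "x \<in> carrier G" "y \<in> carrier G" "g \<in> carrier G"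
    and "inv x \<otimes> g \<otimes> x = inv y \<otimes> g \<otimes> y"
  shows "(x \<otimes> inv y) \<otimes> g = g \<otimes> (x \<otimes> inv y)"
proof -
  have "g \<otimes> (x \<otimes> inv y) = x \<otimes> (inv x \<otimes> g \<otimes> x) \<otimes> inv y"
    using assms(1-3) by (simp add: m_assoc)
  also have "\<dots> = x \<otimes> (inv y \<otimes> g \<otimes> y) \<otimes> inv y"
    by (simp only: assms(4))
  also have "\<dots> = (x \<otimes> inv y) \<otimes> g"
    using assms(1-3) by (simp add: m_assoc)
  finally show ?thesis by simp
qed

lemma conj_mult:
  assumes "h \<in> carrier G" "x \<in> carrier G" "y \<in> carrier G"
  shows "h \<otimes> (x \<otimes> y) \<otimes> inv h = (h \<otimes> x \<otimes> inv h) \<otimes> (h \<otimes> y \<otimes> inv h)"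
  using assms by (simp add: m_assoc)

text \<open>Conjugation by \<open>h\<close> is multiplicative, so every conjugate of
  \<open>x \<otimes> y\<close> is a conjugate of \<open>x\<close> times a conjugate of
  \<open>y\<close>.\<close>

lemma conjugates_mult_card:
  assumes "H \<subseteq> carrier G" "finite H" "x \<in> carrier G" "y \<in> carrier G"
  shows "card (conjugates G H (x \<otimes> y)) \<le> card (conjugates G H x) * card (conjugates G H y)"
proof -
  have "conjugates G H (x \<otimes> y) \<subseteq> (\<lambda>(p, q). p \<otimes> q) ` (conjugates G H x \<times> conjugates G H y)"
    using assms conj_mult by (fastforce simp: conjugates_def image_iff)
  from surj_card_le[OF _ this] show ?thesis
    using assms by (simp add: card_cartesian_product conjugates_finite)
qed

lemma conjugates_inv_card:
  assumes "H \<subseteq> carrier G" "finite H" "x \<in> carrier G"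
  shows "card (conjugates G H (inv x)) \<le> card (conjugates G H x)"
proof -
  have "conjugates G H (inv x) = (\<lambda>p. inv p) ` conjugates G H x"
    unfolding conjugates_def image_image
    using assms by (intro image_cong refl) (auto simp: inv_mult_group m_assoc subset_iff)
  then show ?thesis
    using assms by (simp add: card_image_le conjugates_finite)
qed

lemma card_conjugates_one:
  assumes "H \<subseteq> carrier G"
  shows "card (conjugates G H \<one>) \<le> 1"
proof -
  have "conjugates G H \<one> \<subseteq> {\<one>}"
    using assms by (auto simp: conjugates_def)
  from card_mono[OF _ this] show ?thesis by simp
qed

text \<open>The needed half of orbit-stabilizer: every fibre of
  \<open>h \<mapsto> h \<otimes> x \<otimes> inv h\<close> on \<open>H\<close> contains a left
  translate of the centralizer of \<open>x\<close> in \<open>H\<close>.\<close>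

lemma card_conjugates_mult_centralizer:
  assumes "subgroup H G" "finite H" "x \<in> carrier G"
  shows "card (conjugates G H x) * card {h \<in> H. x \<otimes> h = h \<otimes> x} \<le> card H"
proof -
  let ?C = "{h \<in> H. x \<otimes> h = h \<otimes> x}" and ?f = "\<lambda>h. h \<otimes> x \<otimes> inv h"
  have H: "\<And>h. h \<in> H \<Longrightarrow> h \<in> carrier G"
    using subgroup.mem_carrier[OF assms(1)] .
  have fib: "card ?C \<le> card {h \<in> H. ?f h = c}" if c: "c \<in> conjugates G H x" for c
  proof -
    obtain k where k: "k \<in> H" "c = ?f k" using c by (auto simp: conjugates_def)
    show ?thesis
    proof (rule card_inj_on_le)
      show "inj_on (\<lambda>z. k \<otimes> z) ?C"
        using k H by (auto simp: inj_on_def)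
      show "(\<lambda>z. k \<otimes> z) ` ?C \<subseteq> {h \<in> H. ?f h = c}"
      proof safe
        fix z assume z: "z \<in> H" "x \<otimes> z = z \<otimes> x"
        show "k \<otimes> z \<in> H" using assms k z by (simp add: subgroup.m_closed)
        have "(k \<otimes> z) \<otimes> x \<otimes> inv (k \<otimes> z) = k \<otimes> (z \<otimes> x) \<otimes> inv z \<otimes> inv k"
          using k(1) z(1) H assms(3) by (simp add: m_assoc inv_mult_group)
        also have "\<dots> = k \<otimes> (x \<otimes> z) \<otimes> inv z \<otimes> inv k"
          by (simp only: z(2))
        also have "\<dots> = ?f k"
          using k(1) z(1) H assms(3) by (simp add: m_assoc)
        finally show "(k \<otimes> z) \<otimes> x \<otimes> inv (k \<otimes> z) = c" using k by simp
      qed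
      show "finite {h \<in> H. ?f h = c}" using assms by simp
    qed
  qed
  have "card H = (\<Sum>c\<in>conjugates G H x. card {h \<in> H. ?f h = c})"
    using sum.image_gen[OF assms(2), of "\<lambda>_. 1::nat" ?f] by (simp add: conjugates_def)
  also have "\<dots> \<ge> (\<Sum>c\<in>conjugates G H x. card ?C)"
    by (rule sum_mono) (rule fib)
  finally show ?thesis by simp
qed

section \<open>Subgroups of bounded index whose elements have few conjugates\<close>

text \<open>A Markov-type count of the commuting pairs, multiplied by \<open>k\<close>. The total is
  at least \<open>2 * card A * card B\<close>. An \<open>x\<close> with more than \<open>k\<close>
  conjugates contributes at most \<open>card B\<close>, any other at most \<open>k * card B\<close>.
  The many-conjugate elements therefore account for at most half of the total, and the others must
  supply the rest.\<close>

lemma card_small_conjugates: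
  fixes \<epsilon> :: real and k :: nat
  assumes "subgroup A G" "subgroup B G" "finite A" "finite B"
    and k: "k * \<epsilon> \<ge> 2" "k > 0"
    and prob: "card {(x, y). x \<in> A \<and> y \<in> B \<and> x \<otimes> y = y \<otimes> x} \<ge> \<epsilon> * card A * card B"
  shows "card A \<le> k * card {x \<in> A. card (conjugates G B x) \<le> k}"
proof -
  let ?X = "{x \<in> A. card (conjugates G B x) \<le> k}"
  let ?Z = "\<lambda>x. {y \<in> B. x \<otimes> y = y \<otimes> x}"
  have A: "\<And>x. x \<in> A \<Longrightarrow> x \<in> carrier G"
    using subgroup.mem_carrier[OF assms(1)] .
  have B0: "card B > 0"
    using assms by (metis card_gt_0_iff subgroup.one_closed empty_iff)
  have "{(x, y). x \<in> A \<and> y \<in> B \<and> x \<otimes> y = y \<otimes> x} = Sigma A ?Z"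
    by auto
  then have "card {(x, y). x \<in> A \<and> y \<in> B \<and> x \<otimes> y = y \<otimes> x} = (\<Sum>x\<in>A. card (?Z x))"
    using assms by simp
  then have "k * (\<epsilon> * card A * card B) \<le> real k * (\<Sum>x\<in>A. card (?Z x))"
    using prob k by (intro mult_left_mono) auto
  also have "\<dots> = real (\<Sum>x\<in>A. k * card (?Z x))"
    by (simp add: sum_distrib_left)
  also have "(\<Sum>x\<in>A. k * card (?Z x)) \<le> (\<Sum>x\<in>A. (if x \<in> ?X then k * card B else 0) + card B)"
  proof (rule sum_mono)
    fix x assume x: "x \<in> A"
    show "k * card (?Z x) \<le> (if x \<in> ?X then k * card B else 0) + card B"
    proof (cases "x \<in> ?X")
      case True
      have "card (?Z x) \<le> card B" using assms by (intro card_mono) auto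
      then show ?thesis using True by (simp add: trans_le_add1)
    next
      case False
      then have "k * card (?Z x) \<le> card (conjugates G B x) * card (?Z x)"
        using x by (intro mult_right_mono) auto
      also have "\<dots> \<le> card B"
        using card_conjugates_mult_centralizer[OF assms(2,4)] x A by blast
      finally show ?thesis by simp
    qed
  qed
  also have "\<dots> = (\<Sum>x\<in>?X. k * card B) + (\<Sum>x\<in>A. card B)"
    using assms(3) by (simp add: sum.distrib flip: sum.inter_filter)
  also have "\<dots> = (k * card ?X + card A) * card B"
    by (simp add: algebra_simps)
  finally have "(k * \<epsilon> * card A) * card B \<le> (k * card ?X + card A) * card B"
    by (simp add: algebra_simps)
  then have "k * \<epsilon> * card A \<le> k * card ?X + card A"
    using B0 by simp
  moreover have "2 * real (card A) \<le> k * \<epsilon> * card A"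
    using k by (intro mult_right_mono) auto
  ultimately have "real (card A) \<le> real (k * card ?X)" by simp
  then show ?thesis by linarith
qed

text \<open>If \<open>g\<close> lies in \<open>X (j + 2)\<close> but not in \<open>X (j + 1)\<close>, then \<open>g X 0\<close> is disjoint from \<open>X j\<close> and
  contained in \<open>X (j + 3)\<close>; so a chain that never stabilises gains \<open>card (X 0)\<close> elements every
  three steps.\<close>

lemma subgroup_in_chain:
  fixes X :: "nat \<Rightarrow> 'a set"
  assumes A: "A \<subseteq> carrier G" "finite A"
    and X: "\<And>j. X j \<subseteq> A" "\<And>j. \<one> \<in> X j"
    and inv: "\<And>j x. x \<in> X j \<Longrightarrow> inv x \<in> X j"
    and mult: "\<And>j x y. \<lbrakk>x \<in> X j; y \<in> X j\<rbrakk> \<Longrightarrow> x \<otimes> y \<in> X (Suc j)"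
    and N: "card A \<le> N * card (X 0)"
  shows "\<exists>j \<le> 3 * N. subgroup (X j) G"
proof (rule ccontr)
  assume none: "\<not> ?thesis"
  have carr: "x \<in> carrier G" if "x \<in> X j" for j x using that X(1)[of j] A(1) by auto
  have fin: "finite (X j)" for j using X A finite_subset by blast
  have step: "X j \<subseteq> X (Suc j)" for j
    using mult[OF _ X(2)] carr by fastforce
  have sub: "X i \<subseteq> X j" if "i \<le> j" for i j
    using lift_Suc_mono_le[of X, OF step that] .
  \<comment> \<open>If \<open>X (Suc j)\<close> were inside \<open>X j\<close>, the product rule
    would make \<open>X j\<close> closed under multiplication, hence a subgroup.\<close>
  have strict: "\<exists>g. g \<in> X (Suc j) \<and> g \<notin> X j" if "j \<le> 3 * N" for j
  proof (rule ccontr)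
    assume "\<not> ?thesis"
    then have "X (Suc j) \<subseteq> X j" by blast
    then have "subgroup (X j) G"
      using carr X(2)[of j] inv mult by (intro subgroupI) auto
    with none that show False by blast
  qed
  have "(i + 1) * card (X 0) \<le> card (X (3 * i))" if "i \<le> N" for i
    using that
  proof (induction i)
    case 0
    then show ?case by simp
  next
    case (Suc i)
    obtain g where g: "g \<in> X (Suc (Suc (3 * i)))" "g \<notin> X (Suc (3 * i))"
      using strict[of "Suc (3 * i)"] Suc.prems by auto
    let ?Y = "(\<lambda>x. g \<otimes> x) ` X 0"
    have "inj_on (\<lambda>x. g \<otimes> x) (X 0)"
      using g(1) carr by (auto simp: inj_on_def)
    then have cY: "card ?Y = card (X 0)" by (rule card_image)
    have "g \<otimes> x \<notin> X (3 * i)" if "x \<in> X 0" for x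
    proof
      assume "g \<otimes> x \<in> X (3 * i)"
      moreover have "inv x \<in> X (3 * i)" using that inv sub[of 0 "3 * i"] by blast
      ultimately have "g \<otimes> x \<otimes> inv x \<in> X (Suc (3 * i))" by (rule mult)
      then show False using g carr that by (simp add: m_assoc)
    qed
    then have disj: "X (3 * i) \<inter> ?Y = {}" by blast
    have Y: "?Y \<subseteq> X (3 * Suc i)"
      using mult[OF g(1)] sub[of 0 "Suc (Suc (3 * i))"] by (auto simp: eval_nat_numeral)
    have "card (X (3 * i)) + card ?Y = card (X (3 * i) \<union> ?Y)"
      using disj fin by (simp add: card_Un_disjoint)
    also have "\<dots> \<le> card (X (3 * Suc i))"
      using Y sub[of "3 * i" "3 * Suc i"] fin by (intro card_mono) auto
    finally show ?case using Suc cY by simp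
  qed
  \<comment> \<open>After \<open>3 * N\<close> strict steps the chain has outgrown \<open>A\<close>,
    which has room for only \<open>N\<close> copies of \<open>X 0\<close>.\<close>
  from this[of N] have "(N + 1) * card (X 0) \<le> card A"
    using card_mono[OF A(2) X(1)] order_trans by blast
  moreover have "card (X 0) > 0" using X(2) fin card_gt_0_iff by blast
  ultimately show False using N by simp
qed

text \<open>Elements with few conjugates form a chain to which \<open>subgroup_in_chain\<close>
  applies, and \<open>card_small_conjugates\<close> makes its first member large. The subgroup found
  contains that first member, which bounds its index by \<open>k\<close>.\<close>

lemma subgroup_small_conjugates:
  fixes \<epsilon> :: real and k :: nat
  assumes A: "subgroup A G" and B: "subgroup B G" and fin: "finite A" "finite B"
    and k: "k * \<epsilon> \<ge> 2" "k > 0"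
    and prob: "card {(x, y). x \<in> A \<and> y \<in> B \<and> x \<otimes> y = y \<otimes> x} \<ge> \<epsilon> * card A * card B"
  shows "\<exists>D. subgroup D G \<and> D \<subseteq> A \<and> subgroup_index G A D \<le> k \<and>
             (\<forall>x\<in>D. card (conjugates G B x) \<le> k ^ (2 ^ (3 * k)))"
proof -
  \<comment> \<open>Multiplying two elements squares the bound on conjugates, hence the exponent
    \<open>2 ^ j\<close>; for \<open>j = 0\<close> the bound is \<open>k\<close> itself.\<close>
  define X where "X j = {x \<in> A. card (conjugates G B x) \<le> k ^ (2 ^ j)}" for j :: nat
  have X0: "card A \<le> k * card (X 0)"
    using card_small_conjugates[OF assms] by (simp add: X_def)
  have sub: "A \<subseteq> carrier G" "B \<subseteq> carrier G"
    using A B subgroup.subset by auto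
  have "\<exists>j \<le> 3 * k. subgroup (X j) G"
  proof (rule subgroup_in_chain[OF sub(1) fin(1)])
    show "X j \<subseteq> A" for j by (auto simp: X_def)
    show "\<one> \<in> X j" for j
      using card_conjugates_one[OF sub(2)] subgroup.one_closed[OF A] k(2)
      by (auto simp: X_def intro: order_trans)
    show "inv x \<in> X j" if "x \<in> X j" for j x
      using that conjugates_inv_card[OF sub(2) fin(2)] subgroup.m_inv_closed[OF A] sub
      by (auto simp: X_def intro: order_trans)
    show "x \<otimes> y \<in> X (Suc j)" if "x \<in> X j" "y \<in> X j" for j x y
    proof -
      have "card (conjugates G B (x \<otimes> y)) \<le> card (conjugates G B x) * card (conjugates G B y)"
        using that sub fin by (intro conjugates_mult_card) (auto simp: X_def)
      also have "\<dots> \<le> k ^ (2 ^ j) * k ^ (2 ^ j)"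
        using that by (intro mult_le_mono) (auto simp: X_def)
      also have "\<dots> = k ^ (2 ^ Suc j)"
        by (simp add: power_add [symmetric] mult_2)
      finally show ?thesis
        using that subgroup.m_closed[OF A] by (auto simp: X_def)
    qed
  qed (rule X0)
  then obtain j where j: "j \<le> 3 * k" "subgroup (X j) G" by blast
  have XA: "X j \<subseteq> A" by (auto simp: X_def)
  have "(1::nat) \<le> 2 ^ j" by simp
  then have "k ^ 1 \<le> k ^ (2 ^ j)" using k(2) by (intro power_increasing) auto
  then have "X 0 \<subseteq> X j" by (auto simp: X_def)
  then have "card (X 0) \<le> card (X j)"
    using XA fin finite_subset by (intro card_mono) auto
  then have "subgroup_index G A (X j) * card (X j) \<le> k * card (X j)"
    using X0 subgroup_index_mult_card[OF A j(2) XA] by (metis mult_le_mono2 order_trans)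
  moreover have "card (X j) > 0"
    using j(2) XA fin finite_subset card_gt_0_iff subgroup.one_closed by (metis empty_iff)
  ultimately have "subgroup_index G A (X j) \<le> k" by simp
  moreover have "card (conjugates G B x) \<le> k ^ (2 ^ (3 * k))" if "x \<in> X j" for x
  proof -
    have "k ^ (2 ^ j) \<le> k ^ (2 ^ (3 * k))"
      using j(1) k(2) by (intro power_increasing) auto
    then show ?thesis using that by (auto simp: X_def)
  qed
  ultimately show ?thesis using j(2) XA by blast
qed

section \<open>Normal cores\<close>

text \<open>The core is the kernel of the action of \<open>G\<close> on the right cosets of
  \<open>H\<close>. Its index is at most the number of maps from the set of cosets to
  itself.\<close>

lemma normal_core:
  assumes H: "subgroup H G" and fin: "finite (carrier G)"
  shows "\<exists>N. N \<lhd> G \<and> N \<subseteq> H \<and> subgroup_index G (carrier G) N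
           \<le> subgroup_index G (carrier G) H ^ subgroup_index G (carrier G) H"
proof -
  define N where "N = {g \<in> carrier G. \<forall>h\<in>carrier G. h \<otimes> g \<otimes> inv h \<in> H}"
  have sub: "subgroup N G"
  proof (rule subgroupI)
    show "N \<noteq> {}"
      using subgroup.one_closed[OF H] by (auto simp: N_def)
  next
    fix a assume a: "a \<in> N"
    have "h \<otimes> inv a \<otimes> inv h = inv (h \<otimes> a \<otimes> inv h)" if "h \<in> carrier G" for h
      using a that by (simp add: N_def inv_mult_group m_assoc)
    then show "inv a \<in> N"
      using a subgroup.m_inv_closed[OF H] by (simp add: N_def)
  next
    fix a b assume "a \<in> N" "b \<in> N"
    then show "a \<otimes> b \<in> N"
      using subgroup.m_closed[OF H] by (simp add: N_def conj_mult)
  qed (auto simp: N_def)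
  have "x \<otimes> g \<otimes> inv x \<in> N" if "x \<in> carrier G" "g \<in> N" for x g
  proof -
    have "h \<otimes> (x \<otimes> g \<otimes> inv x) \<otimes> inv h = (h \<otimes> x) \<otimes> g \<otimes> inv (h \<otimes> x)" if "h \<in> carrier G" for h
      using that \<open>x \<in> carrier G\<close> \<open>g \<in> N\<close> by (simp add: N_def inv_mult_group m_assoc)
    then show ?thesis
      using that by (simp add: N_def)
  qed
  with sub have "N \<lhd> G" by (simp add: normal_inv_iff)
  moreover have "N \<subseteq> H"
  proof
    fix g assume "g \<in> N"
    then have "\<one> \<otimes> g \<otimes> inv \<one> \<in> H" "g \<in> carrier G"
      unfolding N_def by blast+
    then show "g \<in> H" by simp
  qed
  moreover define C where "C = (\<lambda>x. H #> x) ` carrier G"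
  then have C: "finite C" "card C = subgroup_index G (carrier G) H"
    using fin by (simp_all add: subgroup_index_alt)
  have "subgroup_index G (carrier G) N \<le> card (C \<rightarrow>\<^sub>E C)"
  proof (rule subgroup_index_le_fibres[OF subgroup_self sub, where f = "\<lambda>g. restrict (\<lambda>c. c #> g) C"])
    show "finite (C \<rightarrow>\<^sub>E C)" using C by (simp add: finite_PiE)
    show "(\<lambda>g. restrict (\<lambda>c. c #> g) C) ` carrier G \<subseteq> C \<rightarrow>\<^sub>E C"
      using subgroup.subset[OF H] by (auto simp: C_def coset_mult_assoc)
    fix x y assume xy: "x \<in> carrier G" "y \<in> carrier G"
      and eq: "restrict (\<lambda>c. c #> x) C = restrict (\<lambda>c. c #> y) C"
    \<comment> \<open>Acting equally on the coset \<open>H #> h\<close> means exactly that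
      \<open>x \<otimes> inv y\<close>, conjugated by \<open>h\<close>, lies in
      \<open>H\<close>.\<close>
    have "h \<otimes> (x \<otimes> inv y) \<otimes> inv h \<in> H" if h: "h \<in> carrier G" for h
    proof -
      have "H #> h \<in> C" using h by (simp add: C_def)
      then have "H #> h #> x = H #> h #> y"
        using eq by (metis restrict_apply')
      then have "H #> (h \<otimes> x) = H #> (h \<otimes> y)"
        using h xy subgroup.subset[OF H] by (simp add: coset_mult_assoc)
      then have "h \<otimes> x \<in> H #> (h \<otimes> y)"
        using rcos_self[OF _ H, of "h \<otimes> x"] h xy by simp
      then obtain p where p: "p \<in> H" "h \<otimes> x = p \<otimes> (h \<otimes> y)"
        by (auto simp: r_coset_def)
      have "h \<otimes> (x \<otimes> inv y) \<otimes> inv h = (h \<otimes> x) \<otimes> inv y \<otimes> inv h"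
        using h xy by (simp add: m_assoc)
      also have "\<dots> = p"
        unfolding p(2) using h xy subgroup.mem_carrier[OF H p(1)] by (simp add: m_assoc)
      finally show ?thesis using p by simp
    qed
    then show "x \<otimes> inv y \<in> N"
      using xy by (simp add: N_def)
  qed
  then have "subgroup_index G (carrier G) N
      \<le> subgroup_index G (carrier G) H ^ subgroup_index G (carrier G) H"
    using C by (simp add: card_PiE)
  ultimately show ?thesis by blast
qed

section \<open>Neumann's argument and the order of the commutator subgroup\<close>

text \<open>This is Neumann's argument: if \<open>u\<close> commutes with representatives \<open>r\<close> of the conjugates of \<open>a\<close>,
  then the \<open>r (a u) r\<^sup>-\<^sup>1 = (r a r\<^sup>-\<^sup>1) u\<close> are, by maximality of \<open>a\<close>, all the conjugates of \<open>a u\<close>.\<close>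

lemma commutators_in_conjugates:
  assumes T: "subgroup T G" "finite T" and B: "subgroup B G" and a: "a \<in> B"
    and max: "\<And>b. b \<in> B \<Longrightarrow> card (conjugates G T b) \<le> card (conjugates G T a)"
  shows "\<exists>R. R \<subseteq> T \<and> card R = card (conjugates G T a) \<and>
    (\<forall>u\<in>B. (\<forall>r\<in>R. u \<otimes> r = r \<otimes> u) \<longrightarrow> (\<forall>t\<in>T. t \<otimes> u \<otimes> inv t \<otimes> inv u
       \<in> (\<lambda>(d, c). inv d \<otimes> c) ` (conjugates G T a \<times> conjugates G T a)))"
proof -
  have Tc: "t \<in> carrier G" if "t \<in> T" for t using subgroup.mem_carrier[OF T(1) that] .
  have Bc: "t \<in> carrier G" if "t \<in> B" for t using subgroup.mem_carrier[OF B that] .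
  \<comment> \<open>\<open>R\<close> contains exactly one conjugating element for each conjugate of
    \<open>a\<close>.\<close>
  obtain R where R: "R \<subseteq> T" "inj_on (\<lambda>h. h \<otimes> a \<otimes> inv h) R"
      "conjugates G T a = (\<lambda>h. h \<otimes> a \<otimes> inv h) ` R"
    using subset_image_inj[of "conjugates G T a" "\<lambda>h. h \<otimes> a \<otimes> inv h" T]
    by (auto simp: conjugates_def)
  have conj_carr: "c \<in> carrier G" if "c \<in> conjugates G T a" for c
    using that Tc Bc a by (auto simp: conjugates_def)
  have "t \<otimes> u \<otimes> inv t \<otimes> inv u
       \<in> (\<lambda>(d, c). inv d \<otimes> c) ` (conjugates G T a \<times> conjugates G T a)"
    if u: "u \<in> B" "\<And>r. r \<in> R \<Longrightarrow> u \<otimes> r = r \<otimes> u" and t: "t \<in> T" for u t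
  proof -
    have carr: "a \<in> carrier G" "u \<in> carrier G" "t \<in> carrier G"
      using Bc a u Tc t by auto
    have "r \<otimes> a \<otimes> inv r \<otimes> u = r \<otimes> (a \<otimes> u) \<otimes> inv r" if r: "r \<in> R" for r
    proof -
      have rc: "r \<in> carrier G" using r R Tc by blast
      have "inv r \<otimes> u = u \<otimes> inv r"
        using u(2)[OF r] rc carr by (metis inv_solve_left inv_solve_right m_assoc m_closed inv_closed)
      then have "r \<otimes> a \<otimes> (inv r \<otimes> u) = r \<otimes> a \<otimes> (u \<otimes> inv r)" by simp
      then show ?thesis using rc carr by (simp add: m_assoc)
    qed
    then have "(\<lambda>c. c \<otimes> u) ` conjugates G T a \<subseteq> conjugates G T (a \<otimes> u)"
      using R by (auto simp: conjugates_def)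
    moreover have "card ((\<lambda>c. c \<otimes> u) ` conjugates G T a) = card (conjugates G T a)"
      using carr conj_carr by (intro card_image) (auto simp: inj_on_def)
    ultimately have eq: "(\<lambda>c. c \<otimes> u) ` conjugates G T a = conjugates G T (a \<otimes> u)"
      using max[OF subgroup.m_closed[OF B a u(1)]] T(2)
      by (intro card_seteq) (auto simp: conjugates_finite)
    \<comment> \<open>An arbitrary \<open>t\<close>, not only a representative, now sends
      \<open>a \<otimes> u\<close> to some \<open>c \<otimes> u\<close>. Cancelling the conjugate
      \<open>t \<otimes> a \<otimes> inv t\<close> on the left and \<open>u\<close> on the right
      leaves the commutator of \<open>t\<close> and \<open>u\<close>.\<close>
    have "t \<otimes> (a \<otimes> u) \<otimes> inv t \<in> conjugates G T (a \<otimes> u)"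
      using t by (auto simp: conjugates_def)
    then obtain c where c: "c \<in> conjugates G T a" "t \<otimes> (a \<otimes> u) \<otimes> inv t = c \<otimes> u"
      using eq by auto
    let ?d = "t \<otimes> a \<otimes> inv t"
    have d: "?d \<in> conjugates G T a" using t by (auto simp: conjugates_def)
    have "t \<otimes> u \<otimes> inv t \<otimes> inv u = inv ?d \<otimes> (t \<otimes> (a \<otimes> u) \<otimes> inv t) \<otimes> inv u"
      using carr by (simp add: m_assoc inv_mult_group)
    also have "\<dots> = inv ?d \<otimes> c"
      unfolding c(2) using carr conj_carr[OF c(1)] by (simp add: m_assoc)
    finally show ?thesis using c d by force
  qed
  then show ?thesis
    using R(1) R(3) card_image[OF R(2)] by (intro exI[of _ R]) auto
qed

text \<open>Subgroups central in \<open>T\<close> multiply to a subgroup, and each further factor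
  multiplies the order by at most \<open>n\<close>. One factor for each element of \<open>P\<close>
  suffices.\<close>

lemma card_generate_central_subgroups:
  assumes T: "subgroup T G" "finite T" and P: "finite P"
    and Q: "\<And>p. p \<in> P \<Longrightarrow> \<exists>Q. subgroup Q G \<and> p \<in> Q \<and> Q \<subseteq> T \<and> card Q \<le> n
              \<and> (\<forall>q\<in>Q. \<forall>t\<in>T. q \<otimes> t = t \<otimes> q)"
  shows "card (generate G P) \<le> n ^ card P"
proof -
  have Tc: "t \<in> carrier G" if "t \<in> T" for t using subgroup.mem_carrier[OF T(1) that] .
  \<comment> \<open>Keeping \<open>H\<close> inside \<open>T\<close> ensures that the next central
    factor commutes with it elementwise.\<close>
  have "\<exists>H. subgroup H G \<and> P \<subseteq> H \<and> H \<subseteq> T \<and> card H \<le> n ^ card P"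
    using P Q
  proof (induction P rule: finite_induct)
    case empty
    show ?case
      using subgroup.one_closed[OF T(1)] by (intro exI[of _ "{\<one>}"]) (simp add: triv_subgroup)
  next
    case (insert p P)
    obtain H where H: "subgroup H G" "P \<subseteq> H" "H \<subseteq> T" "card H \<le> n ^ card P"
      using insert.IH insert.prems by blast
    obtain Q where Q: "subgroup Q G" "p \<in> Q" "Q \<subseteq> T" "card Q \<le> n"
        "\<And>q t. q \<in> Q \<Longrightarrow> t \<in> T \<Longrightarrow> q \<otimes> t = t \<otimes> q"
      using insert.prems[of p] by blast
    let ?J = "(\<lambda>(q, h). q \<otimes> h) ` (Q \<times> H)"
    have carr: "q \<in> carrier G" "h \<in> carrier G" if "q \<in> Q" "h \<in> H" for q h
      using that Q H Tc by auto
    have JT: "?J \<subseteq> T"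
      using Q(3) H(3) subgroup.m_closed[OF T(1)] by auto
    have "subgroup ?J G"
    proof (rule subgroupI)
      show "?J \<subseteq> carrier G" using JT Tc by blast
      show "?J \<noteq> {}" using Q(2) subgroup.one_closed[OF H(1)] by auto
    next
      fix x assume "x \<in> ?J"
      then obtain q h where qh: "q \<in> Q" "h \<in> H" "x = q \<otimes> h" by auto
      have "inv q \<otimes> inv h = inv h \<otimes> inv q"
        using subgroup.m_inv_closed[OF Q(1) qh(1)] subgroup.m_inv_closed[OF H(1) qh(2)] H(3)
        by (intro Q(5)) auto
      then have "inv x = inv q \<otimes> inv h"
        using qh carr by (simp add: inv_mult_group)
      then show "inv x \<in> ?J"
        using subgroup.m_inv_closed[OF Q(1) qh(1)] subgroup.m_inv_closed[OF H(1) qh(2)]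
        by (intro image_eqI[of _ _ "(inv q, inv h)"]) auto
    next
      fix x y assume "x \<in> ?J" "y \<in> ?J"
      then obtain q h r k where qh: "q \<in> Q" "h \<in> H" "x = q \<otimes> h"
        and rk: "r \<in> Q" "k \<in> H" "y = r \<otimes> k" by auto
      have rh: "r \<otimes> h = h \<otimes> r" using Q(5) qh rk H(3) by blast
      have "x \<otimes> y = q \<otimes> (h \<otimes> r) \<otimes> k"
        using qh rk carr by (simp add: m_assoc)
      also have "\<dots> = (q \<otimes> r) \<otimes> (h \<otimes> k)"
        unfolding rh [symmetric] using qh rk carr by (simp add: m_assoc)
      finally show "x \<otimes> y \<in> ?J"
        using subgroup.m_closed[OF Q(1) qh(1) rk(1)] subgroup.m_closed[OF H(1) qh(2) rk(2)]
        by (intro image_eqI[of _ _ "(q \<otimes> r, h \<otimes> k)"]) auto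
    qed
    moreover have "insert p P \<subseteq> ?J"
    proof -
      have "p \<otimes> \<one> \<in> ?J" using Q(2) subgroup.one_closed[OF H(1)] by auto
      moreover have "\<one> \<otimes> h \<in> ?J" if "h \<in> H" for h
        using that subgroup.one_closed[OF Q(1)] by auto
      ultimately show ?thesis
        using carr(1)[OF Q(2) subgroup.one_closed[OF H(1)]] carr(2)[OF Q(2)] H(2) by auto
    qed
    moreover have "card ?J \<le> n ^ card (insert p P)"
    proof -
      have "finite Q" "finite H" using T(2) Q(3) H(3) finite_subset by auto
      then have "card ?J \<le> card Q * card H"
        by (metis card_image_le card_cartesian_product finite_cartesian_product)
      also have "\<dots> \<le> n * n ^ card P"
        using Q(4) H(4) by (rule mult_le_mono)
      finally show ?thesis using insert.hyps by simp
    qed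
    ultimately show ?case using JT by blast
  qed
  then obtain H where H: "subgroup H G" "P \<subseteq> H" "H \<subseteq> T" "card H \<le> n ^ card P" by blast
  have "card (generate G P) \<le> card H"
    using generate_subgroup_incl[OF H(2,1)] H(3) T(2) finite_subset by (blast intro: card_mono)
  then show ?thesis using H(4) by simp
qed

text \<open>For fixed \<open>u\<close>, the map taking \<open>t\<close> to its commutator with \<open>u\<close> is a homomorphism on \<open>N\<close>.\<close>

lemma central_commutators_subgroup:
  assumes N: "N \<lhd> G" and u: "u \<in> carrier G"
    and central: "\<And>s t. \<lbrakk>s \<in> N; t \<in> N\<rbrakk> \<Longrightarrow> s \<otimes> (t \<otimes> u \<otimes> inv t \<otimes> inv u) = (t \<otimes> u \<otimes> inv t \<otimes> inv u) \<otimes> s"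
  shows "subgroup ((\<lambda>t. t \<otimes> u \<otimes> inv t \<otimes> inv u) ` N) G"
proof -
  let ?c = "\<lambda>t. t \<otimes> u \<otimes> inv t \<otimes> inv u"
  have sub: "subgroup N G" using N normal_imp_subgroup by blast
  have carr: "t \<in> carrier G" if "t \<in> N" for t using subgroup.mem_carrier[OF sub that] .
  \<comment> \<open>Expanding \<open>?c (s \<otimes> t)\<close> gives
    \<open>s \<otimes> ?c t \<otimes> u \<otimes> inv s \<otimes> inv u\<close>; moving
    \<open>s\<close> past \<open>?c t\<close> yields the product, in reversed order.\<close>
  have mult: "?c t \<otimes> ?c s = ?c (s \<otimes> t)" if "t \<in> N" "s \<in> N" for t s
  proof -
    have "?c (s \<otimes> t) = (s \<otimes> ?c t) \<otimes> u \<otimes> inv s \<otimes> inv u"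
      using that carr u by (simp add: m_assoc inv_mult_group)
    also have "\<dots> = ?c t \<otimes> ?c s"
      unfolding central[OF that(2,1)] using that carr u by (simp add: m_assoc)
    finally show ?thesis by simp
  qed
  show ?thesis
  proof (rule subgroupI)
    show "?c ` N \<subseteq> carrier G" using carr u by auto
    show "?c ` N \<noteq> {}" using subgroup.one_closed[OF sub] by auto
  next
    fix x assume "x \<in> ?c ` N"
    then obtain t where t: "t \<in> N" "x = ?c t" by auto
    have t': "inv t \<in> N" using t subgroup.m_inv_closed[OF sub] by blast
    have "?c (inv t) \<otimes> ?c t = \<one>"
      unfolding mult[OF t' t(1)] using t carr u by simp
    then have "inv x = ?c (inv t)"
      using t t' carr u by (intro inv_equality) auto
    then show "inv x \<in> ?c ` N" using t' by blast
  next
    fix x y assume "x \<in> ?c ` N" "y \<in> ?c ` N"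
    then show "x \<otimes> y \<in> ?c ` N"
      using mult subgroup.m_closed[OF sub] by auto
  qed
qed

lemma commute_inv_mult:
  assumes "x \<in> carrier G" "c \<in> carrier G" "d \<in> carrier G"
    and "x \<otimes> c = c \<otimes> x" "x \<otimes> d = d \<otimes> x"
  shows "x \<otimes> (inv d \<otimes> c) = (inv d \<otimes> c) \<otimes> x"
proof -
  have "inv d \<otimes> (d \<otimes> x) \<otimes> inv d = inv d \<otimes> (x \<otimes> d) \<otimes> inv d"
    using assms(5) by simp
  then have d: "x \<otimes> inv d = inv d \<otimes> x"
    using assms(1-3) by (simp add: m_assoc)
  have "x \<otimes> (inv d \<otimes> c) = (x \<otimes> inv d) \<otimes> c"
    using assms(1-3) by (simp add: m_assoc)
  also have "\<dots> = inv d \<otimes> (x \<otimes> c)"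
    unfolding d using assms(1-3) by (simp add: m_assoc)
  also have "\<dots> = (inv d \<otimes> c) \<otimes> x"
    unfolding assms(4) using assms(1-3) by (simp add: m_assoc)
  finally show ?thesis .
qed

text \<open>For fixed \<open>u\<close> the commutators with elements of \<open>N\<close> form a
  subgroup inside \<open>S\<close> and, by normality, inside \<open>N\<close>, where it is central.
  The generators number at most \<open>card S\<close>, and each lies in such a subgroup of order at
  most \<open>card S\<close>.\<close>

lemma card_commutator_subgroup_central:
  assumes N: "N \<lhd> G" "finite N" and U: "U \<subseteq> carrier G" and S: "finite S"
    and central: "\<And>s x. \<lbrakk>s \<in> S; x \<in> N\<rbrakk> \<Longrightarrow> x \<otimes> s = s \<otimes> x"
    and comm: "\<And>t u. \<lbrakk>t \<in> N; u \<in> U\<rbrakk> \<Longrightarrow> t \<otimes> u \<otimes> inv t \<otimes> inv u \<in> S"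
  shows "card (commutator_subgroup G N U) \<le> card S ^ card S"
proof -
  let ?c = "\<lambda>t u. t \<otimes> u \<otimes> inv t \<otimes> inv u"
  define P where "P = (\<Union>t\<in>N. \<Union>u\<in>U. {?c t u})"
  have sub: "subgroup N G" using N(1) normal_imp_subgroup by blast
  have carr: "t \<in> carrier G" if "t \<in> N" for t using subgroup.mem_carrier[OF sub that] .
  have PS: "P \<subseteq> S" using comm by (auto simp: P_def)
  have inN: "?c t u \<in> N" if "t \<in> N" "u \<in> U" for t u
  proof -
    have "u \<otimes> inv t \<otimes> inv u \<in> N"
      using that U normal.inv_op_closed2[OF N(1)] subgroup.m_inv_closed[OF sub] by blast
    then have "t \<otimes> (u \<otimes> inv t \<otimes> inv u) \<in> N"
      using that subgroup.m_closed[OF sub] by blast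
    then show ?thesis using that U carr by (simp add: m_assoc subset_iff)
  qed
  have "card (generate G P) \<le> card S ^ card P"
  proof (rule card_generate_central_subgroups[OF sub N(2)])
    show "finite P" using PS S finite_subset by blast
    fix p assume "p \<in> P"
    then obtain t u where tu: "t \<in> N" "u \<in> U" "p = ?c t u" by (auto simp: P_def)
    let ?Q = "(\<lambda>t. ?c t u) ` N"
    have QS: "?Q \<subseteq> S" using comm tu by auto
    have "subgroup ?Q G"
    proof (rule central_commutators_subgroup[OF N(1)])
      show "u \<in> carrier G" using tu(2) U by blast
      show "s \<otimes> ?c t u = ?c t u \<otimes> s" if "s \<in> N" "t \<in> N" for s t
        by (rule central[OF comm[OF that(2) tu(2)] that(1)])
    qed
    moreover have "card ?Q \<le> card S" using QS S by (rule card_mono[rotated])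
    moreover have "q \<otimes> x = x \<otimes> q" if "q \<in> ?Q" "x \<in> N" for q x
      using central[OF subsetD[OF QS that(1)] that(2)] by (rule sym)
    ultimately show "\<exists>Q. subgroup Q G \<and> p \<in> Q \<and> Q \<subseteq> N \<and> card Q \<le> card S
              \<and> (\<forall>q\<in>Q. \<forall>t\<in>N. q \<otimes> t = t \<otimes> q)"
      using tu inN by (intro exI[of _ ?Q]) blast
  qed
  also have "\<dots> \<le> card S ^ card S"
  \<comment> \<open>Raising the exponent needs a positive base. For empty \<open>S\<close> both
    sides are \<open>0 ^ 0 = 1\<close>.\<close>
  proof (cases "card S = 0")
    case True
    then have "P = {}" using S PS by auto
    then show ?thesis using True by simp
  next
    case False
    then have "card S \<ge> 1" by simp
    then show ?thesis using PS S by (intro power_increasing card_mono)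
  qed
  finally show ?thesis by (simp add: commutator_subgroup_def P_def)
qed

section \<open>Centralizers and their indices\<close>

lemma subgroup_centralizer_in:
  assumes H: "subgroup H G" and R: "R \<subseteq> carrier G"
  shows "subgroup {x \<in> H. \<forall>r\<in>R. x \<otimes> r = r \<otimes> x} G"
proof (rule subgroupI)
  have carr: "x \<in> carrier G" if "x \<in> H" for x using subgroup.mem_carrier[OF H that] .
  show "{x \<in> H. \<forall>r\<in>R. x \<otimes> r = r \<otimes> x} \<noteq> {}"
    using subgroup.one_closed[OF H] R by (auto intro!: exI[of _ \<one>])
  show "{x \<in> H. \<forall>r\<in>R. x \<otimes> r = r \<otimes> x} \<subseteq> carrier G" using carr by auto
  fix a assume a: "a \<in> {x \<in> H. \<forall>r\<in>R. x \<otimes> r = r \<otimes> x}"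
  have "inv a \<otimes> r = r \<otimes> inv a" if "r \<in> R" for r
    using commute_inv_mult[of r \<one> a] a that R carr[of a] by auto
  then show "inv a \<in> {x \<in> H. \<forall>r\<in>R. x \<otimes> r = r \<otimes> x}"
    using a subgroup.m_inv_closed[OF H] by blast
  fix b assume b: "b \<in> {x \<in> H. \<forall>r\<in>R. x \<otimes> r = r \<otimes> x}"
  have "a \<otimes> b \<otimes> r = r \<otimes> (a \<otimes> b)" if r: "r \<in> R" for r
  proof -
    have c: "a \<in> carrier G" "b \<in> carrier G" "r \<in> carrier G" using a b r R carr by auto
    have "a \<otimes> b \<otimes> r = a \<otimes> (b \<otimes> r)" using c by (simp add: m_assoc)
    also have "\<dots> = (a \<otimes> r) \<otimes> b" using b r c by (simp add: m_assoc)
    also have "\<dots> = r \<otimes> (a \<otimes> b)" using a r c by (simp add: m_assoc)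
    finally show ?thesis .
  qed
  then show "a \<otimes> b \<in> {x \<in> H. \<forall>r\<in>R. x \<otimes> r = r \<otimes> x}"
    using a b subgroup.m_closed[OF H] by blast
qed

text \<open>The coset of \<open>x\<close> modulo the centralizer is determined by
  \<open>H #> x\<close> together with the conjugates \<open>inv x \<otimes> r \<otimes> x\<close>
  for \<open>r\<close> in \<open>R\<close>, each of which has at most \<open>m\<close> possible
  values.\<close>

lemma subgroup_index_centralizer_le:
  assumes K: "subgroup K G" "finite K" and H: "subgroup H G" "H \<subseteq> K"
    and R: "finite R" "R \<subseteq> carrier G" "\<And>r. r \<in> R \<Longrightarrow> card (conjugates G K r) \<le> m"
  shows "subgroup_index G K {x \<in> H. \<forall>r\<in>R. x \<otimes> r = r \<otimes> x}
           \<le> subgroup_index G K H * m ^ card R"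
proof -
  define C where "C = (\<lambda>x. H #> x) ` K"
  have Kc: "x \<in> carrier G" if "x \<in> K" for x using subgroup.mem_carrier[OF K(1) that] .
  let ?F = "C \<times> (\<Pi>\<^sub>E r\<in>R. conjugates G K r)"
  let ?f = "\<lambda>x. (H #> x, restrict (\<lambda>r. inv x \<otimes> r \<otimes> x) R)"
  have "subgroup_index G K {x \<in> H. \<forall>r\<in>R. x \<otimes> r = r \<otimes> x} \<le> card ?F"
  proof (rule subgroup_index_le_fibres[OF K(1) subgroup_centralizer_in[OF H(1) R(2)], where f = ?f])
    show "finite ?F"
      using K(2) R(1) by (auto simp: C_def conjugates_finite intro!: finite_PiE)
    have "inv x \<otimes> r \<otimes> x \<in> conjugates G K r" if "x \<in> K" "r \<in> R" for x r
      unfolding conjugates_def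
      using that Kc subgroup.m_inv_closed[OF K(1)] by (intro image_eqI[of _ _ "inv x"]) auto
    then show "?f ` K \<subseteq> ?F" by (auto simp: C_def)
    fix x y assume xy: "x \<in> K" "y \<in> K" "?f x = ?f y"
    then have coset: "H #> x = H #> y"
      and conj: "restrict (\<lambda>r. inv x \<otimes> r \<otimes> x) R = restrict (\<lambda>r. inv y \<otimes> r \<otimes> y) R" by auto
    have "inv x \<otimes> r \<otimes> x = inv y \<otimes> r \<otimes> y" if "r \<in> R" for r
      using fun_cong[OF conj, of r] that by simp
    then have comm: "(x \<otimes> inv y) \<otimes> r = r \<otimes> (x \<otimes> inv y)" if "r \<in> R" for r
      using that xy Kc R(2) by (intro inv_conj_eq_commute) auto
    have "x \<in> H #> y"
      using rcos_self[OF Kc[OF xy(1)] H(1)] coset by simp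
    then obtain h where h: "h \<in> H" "x = h \<otimes> y" by (auto simp: r_coset_def)
    have "x \<otimes> inv y = h"
      unfolding h(2) using h(1) H(2) Kc xy(2) by (simp add: m_assoc subset_iff)
    then show "x \<otimes> inv y \<in> {x \<in> H. \<forall>r\<in>R. x \<otimes> r = r \<otimes> x}"
      using comm h(1) by simp
  qed
  also have "\<dots> = subgroup_index G K H * (\<Prod>r\<in>R. card (conjugates G K r))"
    using R(1) by (simp add: card_cartesian_product card_PiE C_def subgroup_index_alt)
  also have "\<dots> \<le> subgroup_index G K H * (\<Prod>r\<in>R. m)"
    using R(3) by (intro mult_le_mono2 prod_mono) auto
  finally show ?thesis by simp
qed

section \<open>Constructing the normal subgroup and the subgroup of \<open>K\<close>\<close>

lemma normal_and_subgroup_of_small_conjugates: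
  fixes k m :: nat
  assumes fin: "finite (carrier G)" and K: "subgroup K G"
    and T: "subgroup T G" "subgroup_index G (carrier G) T \<le> k"
       "\<And>t. t \<in> T \<Longrightarrow> card (conjugates G K t) \<le> m"
    and B: "subgroup B G" "B \<subseteq> K" "subgroup_index G K B \<le> k"
       "\<And>b. b \<in> B \<Longrightarrow> card (conjugates G (carrier G) b) \<le> m"
    and pos: "k > 0" "m > 0"
  shows "\<exists>N U. N \<lhd> G \<and> subgroup U G \<and> U \<subseteq> K \<and>
           subgroup_index G (carrier G) N \<le> (k * m) ^ (k * m) \<and>
           subgroup_index G K U \<le> k * m ^ m \<and>
           card (commutator_subgroup G N U) \<le> (m * m) ^ (m * m)"
proof -
  have sub: "T \<subseteq> carrier G" "B \<subseteq> carrier G" "K \<subseteq> carrier G"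
    using T(1) B(1) K subgroup.subset by auto
  have finT: "finite T" and finK: "finite K" using finite_subset[OF _ fin] sub by blast+
  have "conjugates G T b \<subseteq> conjugates G (carrier G) b" for b
    using sub by (auto simp: conjugates_def)
  then have le_m: "card (conjugates G T b) \<le> m" if "b \<in> B" for b
    using that B(4) fin by (meson card_mono conjugates_finite order_trans)
  obtain a where a: "a \<in> B" "\<And>b. b \<in> B \<Longrightarrow> card (conjugates G T b) \<le> card (conjugates G T a)"
    using ex_has_greatest_nat[of "\<lambda>b. b \<in> B" \<one> "\<lambda>b. card (conjugates G T b)" "Suc m"]
      le_m subgroup.one_closed[OF B(1)] by (auto simp: less_Suc_eq_le)
  have ac: "a \<in> carrier G" using a(1) sub by blast
  define S where "S = (\<lambda>(d, c). inv d \<otimes> c) ` (conjugates G T a \<times> conjugates G T a)"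
  have finS: "finite S" using finT by (simp add: S_def conjugates_finite)
  have cS: "card S \<le> m * m"
  proof -
    have "card S \<le> card (conjugates G T a) * card (conjugates G T a)"
      unfolding S_def by (metis card_image_le card_cartesian_product finite_cartesian_product
          conjugates_finite[OF finT])
    also have "\<dots> \<le> m * m" using le_m[OF a(1)] by (intro mult_le_mono)
    finally show ?thesis .
  qed
  obtain R where R: "R \<subseteq> T" "card R = card (conjugates G T a)"
    and RS: "\<And>u t. \<lbrakk>u \<in> B; \<forall>r\<in>R. u \<otimes> r = r \<otimes> u; t \<in> T\<rbrakk> \<Longrightarrow> t \<otimes> u \<otimes> inv t \<otimes> inv u \<in> S"
    using commutators_in_conjugates[OF T(1) finT B(1) a] unfolding S_def by blast
  define U where "U = {u \<in> B. \<forall>r\<in>R. u \<otimes> r = r \<otimes> u}"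
  have U: "subgroup U G"
    unfolding U_def using R(1) sub by (intro subgroup_centralizer_in B(1)) auto
  have finR: "finite R" using R(1) finT finite_subset by blast
  \<comment> \<open>The representatives lie in \<open>T\<close>, so each has at most
    \<open>m\<close> conjugates under \<open>K\<close>; there are at most \<open>m\<close> of
    them.\<close>
  have "subgroup_index G K U \<le> subgroup_index G K B * m ^ card R"
    unfolding U_def using R(1) sub finR T(3)
    by (intro subgroup_index_centralizer_le[OF K finK B(1,2)]) auto
  also have "\<dots> \<le> k * m ^ m"
    using B(3) R(2) le_m[OF a(1)] pos by (intro mult_le_mono power_increasing) auto
  finally have indU: "subgroup_index G K U \<le> k * m ^ m" .
  \<comment> \<open>\<open>H\<close> is the centralizer of \<open>a\<close> in \<open>T\<close>. Its
    index is controlled because \<open>a\<close>, as an element of \<open>B\<close>, has at most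
    \<open>m\<close> conjugates in \<open>G\<close>.\<close>
  define H where "H = {t \<in> T. \<forall>r\<in>{a}. t \<otimes> r = r \<otimes> t}"
  have H: "subgroup H G"
    unfolding H_def using ac by (intro subgroup_centralizer_in T(1)) auto
  have "subgroup_index G (carrier G) H \<le> subgroup_index G (carrier G) T * m ^ card {a}"
    unfolding H_def using ac a(1) B(4)
    by (intro subgroup_index_centralizer_le[OF subgroup_self fin T(1) sub(1)]) auto
  also have "\<dots> \<le> k * m" using T(2) by simp
  finally have indH: "subgroup_index G (carrier G) H \<le> k * m" .
  obtain N where N: "N \<lhd> G" "N \<subseteq> H" "subgroup_index G (carrier G) N
           \<le> subgroup_index G (carrier G) H ^ subgroup_index G (carrier G) H"
    using normal_core[OF H fin] by blast
  let ?h = "subgroup_index G (carrier G) H"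
  have "?h ^ ?h \<le> (k * m) ^ ?h"
    using indH by (rule power_mono) simp
  also have "\<dots> \<le> (k * m) ^ (k * m)"
    using indH pos by (intro power_increasing) (auto simp: Suc_le_eq)
  finally have indN: "subgroup_index G (carrier G) N \<le> (k * m) ^ (k * m)"
    using N(3) by simp
  have Nsub: "N \<subseteq> carrier G" using N(2) H subgroup.subset by blast
  \<comment> \<open>This is where normality of \<open>N\<close> enters: moving \<open>x\<close> back
    by \<open>t\<close> stays in \<open>N\<close>, which commutes with \<open>a\<close>, so
    \<open>N\<close> centralizes all conjugates of \<open>a\<close> under \<open>T\<close>.\<close>
  have conj: "x \<otimes> c = c \<otimes> x" if c: "c \<in> conjugates G T a" and x: "x \<in> N" for c x
  proof -
    obtain t where t: "t \<in> T" "c = t \<otimes> a \<otimes> inv t"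
      using c by (auto simp: conjugates_def)
    have carr: "t \<in> carrier G" "x \<in> carrier G" using t x sub Nsub by auto
    let ?y = "inv t \<otimes> x \<otimes> t"
    have "?y \<in> N" using normal.inv_op_closed1[OF N(1)] carr x by blast
    then have y: "?y \<otimes> a = a \<otimes> ?y" using N(2) by (auto simp: H_def)
    have "x \<otimes> c = t \<otimes> (?y \<otimes> a) \<otimes> inv t"
      unfolding t(2) using carr ac by (simp add: m_assoc)
    also have "\<dots> = c \<otimes> x"
      unfolding y t(2) using carr ac by (simp add: m_assoc)
    finally show ?thesis .
  qed
  have "card (commutator_subgroup G N U) \<le> card S ^ card S"
  proof (rule card_commutator_subgroup_central[OF N(1) _ _ finS])
    show "finite N" using Nsub fin finite_subset by blast
    show "U \<subseteq> carrier G" using U subgroup.subset by blast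
    show "x \<otimes> s = s \<otimes> x" if "s \<in> S" "x \<in> N" for s x
    proof -
      have "c \<in> carrier G" if "c \<in> conjugates G T a" for c
        using that sub ac by (auto simp: conjugates_def)
      moreover obtain d c where "d \<in> conjugates G T a" "c \<in> conjugates G T a" "s = inv d \<otimes> c"
        using \<open>s \<in> S\<close> by (auto simp: S_def)
      ultimately show ?thesis
        using that(2) Nsub conj by (auto intro!: commute_inv_mult)
    qed
    show "t \<otimes> u \<otimes> inv t \<otimes> inv u \<in> S" if "t \<in> N" "u \<in> U" for t u
      using that N(2) by (intro RS) (auto simp: U_def H_def)
  qed
  also have "\<dots> \<le> (m * m) ^ card S"
    using cS by (rule power_mono) simp
  also have "\<dots> \<le> (m * m) ^ (m * m)"
    using cS pos by (intro power_increasing) (auto simp: Suc_le_eq)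
  finally have "card (commutator_subgroup G N U) \<le> (m * m) ^ (m * m)" .
  moreover have "U \<subseteq> K" using B(2) by (auto simp: U_def)
  ultimately show ?thesis using N(1) U indU indN by blast
qed

text \<open>Commuting is symmetric, so \<open>subgroup_small_conjugates\<close> can be applied to
  the same count twice: with \<open>K\<close> first it yields \<open>B\<close>, with
  \<open>G\<close> first it yields \<open>T\<close>.\<close>

lemma commuting_prob_bounded:
  fixes \<epsilon> :: real and k :: nat
  assumes fin: "finite (carrier G)" and K: "subgroup K G"
    and prob: "commuting_prob G K \<ge> \<epsilon>" and k: "k * \<epsilon> \<ge> 2" "k > 0"
  defines "m \<equiv> k ^ (2 ^ (3 * k))"
  shows "\<exists>N U. N \<lhd> G \<and> subgroup U G \<and> U \<subseteq> K \<and>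
           subgroup_index G (carrier G) N \<le> (k * m) ^ (k * m) \<and>
           subgroup_index G K U \<le> k * m ^ m \<and>
           card (commutator_subgroup G N U) \<le> (m * m) ^ (m * m)"
proof -
  have finK: "finite K" using K fin finite_subset subgroup.subset by blast
  have pos: "card K > 0" "card (carrier G) > 0"
    using K fin finK subgroup.one_closed one_closed card_gt_0_iff by (metis empty_iff)+
  have 1: "card {(x, y). x \<in> K \<and> y \<in> carrier G \<and> x \<otimes> y = y \<otimes> x} \<ge> \<epsilon> * card K * card (carrier G)"
    using prob pos by (simp add: commuting_prob_def order_def pos_le_divide_eq mult.assoc)
  have "{(y, x). y \<in> carrier G \<and> x \<in> K \<and> y \<otimes> x = x \<otimes> y}
      = prod.swap ` {(x, y). x \<in> K \<and> y \<in> carrier G \<and> x \<otimes> y = y \<otimes> x}"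
    by (auto simp: image_iff)
  then have 2: "card {(y, x). y \<in> carrier G \<and> x \<in> K \<and> y \<otimes> x = x \<otimes> y} \<ge> \<epsilon> * card (carrier G) * card K"
    using 1 by (simp add: card_image mult_ac)
  obtain B where B: "subgroup B G" "B \<subseteq> K" "subgroup_index G K B \<le> k"
    "\<And>x. x \<in> B \<Longrightarrow> card (conjugates G (carrier G) x) \<le> m"
    using subgroup_small_conjugates[OF K subgroup_self finK fin k 1] unfolding m_def by blast
  obtain T where T: "subgroup T G" "subgroup_index G (carrier G) T \<le> k"
    "\<And>x. x \<in> T \<Longrightarrow> card (conjugates G K x) \<le> m"
    using subgroup_small_conjugates[OF subgroup_self K fin finK k 2] unfolding m_def by blast
  show ?thesis
    using normal_and_subgroup_of_small_conjugates[OF fin K T B k(2)] k(2) by (simp add: m_def)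
qed

end

section \<open>Transport along isomorphisms and the uniform bound\<close>

lemma (in group_hom) commutator_subgroup_img:
  assumes "T \<subseteq> carrier G" "B \<subseteq> carrier G"
  shows "commutator_subgroup H (h ` T) (h ` B) = h ` commutator_subgroup G T B"
proof -
  let ?P = "\<Union>t\<in>T. \<Union>b\<in>B. {t \<otimes> b \<otimes> inv t \<otimes> inv b}"
  have "?P \<subseteq> carrier G" using assms by (blast intro: G.m_closed G.inv_closed)
  moreover have "(\<Union>t\<in>h ` T. \<Union>b\<in>h ` B. {t \<otimes>\<^bsub>H\<^esub> b \<otimes>\<^bsub>H\<^esub> inv\<^bsub>H\<^esub> t \<otimes>\<^bsub>H\<^esub> inv\<^bsub>H\<^esub> b}) = h ` ?P"
    using assms by (force simp: image_UN subset_iff)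
  ultimately show ?thesis
    using generate_img by (simp add: commutator_subgroup_def)
qed

lemma (in group_hom) normal_subgroup_pair_img:
  fixes C :: nat
  assumes iso: "inj_on h (carrier G)" "h ` carrier G = carrier H" and fin: "finite (carrier G)"
    and K: "subgroup K G"
    and T: "T \<lhd> G" and B: "subgroup B G" "B \<subseteq> K"
    and C: "subgroup_index G (carrier G) T \<le> C" "subgroup_index G K B \<le> C"
      "card (commutator_subgroup G T B) \<le> C"
  shows "h ` T \<lhd> H \<and> subgroup (h ` B) H \<and> h ` B \<subseteq> h ` K \<and>
         subgroup_index H (carrier H) (h ` T) \<le> C \<and>
         subgroup_index H (h ` K) (h ` B) \<le> C \<and>
         card (commutator_subgroup H (h ` T) (h ` B)) \<le> C"
proof -
  have subT: "subgroup T G" using T normal_imp_subgroup by blast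
  have sub: "T \<subseteq> carrier G" "B \<subseteq> carrier G" "K \<subseteq> carrier G"
    using subT B K subgroup.subset by auto
  \<comment> \<open>Comparing cosets is avoided: by Lagrange both indices, multiplied by
    \<open>card L\<close>, give \<open>card A\<close>.\<close>
  have index: "subgroup_index H (h ` A) (h ` L) = subgroup_index G A L"
    if A: "subgroup A G" and L: "subgroup L G" "L \<subseteq> A" for A L
  proof -
    have c: "card (h ` X) = card X" if "X \<subseteq> carrier G" for X
      using iso(1) that by (meson card_image inj_on_subset)
    have "subgroup_index H (h ` A) (h ` L) * card (h ` L) = card (h ` A)"
      using that by (intro H.subgroup_index_mult_card subgroup_img_is_subgroup) auto
    then have "subgroup_index H (h ` A) (h ` L) * card L = subgroup_index G A L * card L"
      using c A L subgroup.subset G.subgroup_index_mult_card[OF A L] by metis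
    moreover have "card L > 0"
      using L(1) fin finite_subset subgroup.one_closed subgroup.subset card_gt_0_iff
      by (metis empty_iff)
    ultimately show ?thesis by simp
  qed
  have "h ` T \<lhd> H"
    unfolding H.normal_inv_iff
  proof (intro conjI ballI)
    show "subgroup (h ` T) H" using subT by (rule subgroup_img_is_subgroup)
    fix x y assume "x \<in> carrier H" "y \<in> h ` T"
    then obtain g t where gt: "g \<in> carrier G" "x = h g" "t \<in> T" "y = h t"
      using iso(2) by blast
    then have "x \<otimes>\<^bsub>H\<^esub> y \<otimes>\<^bsub>H\<^esub> inv\<^bsub>H\<^esub> x = h (g \<otimes> t \<otimes> inv g)"
      using sub by (simp add: subset_iff)
    then show "x \<otimes>\<^bsub>H\<^esub> y \<otimes>\<^bsub>H\<^esub> inv\<^bsub>H\<^esub> x \<in> h ` T"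
      using gt normal.inv_op_closed2[OF T] by blast
  qed
  moreover have "card (commutator_subgroup H (h ` T) (h ` B)) \<le> C"
  proof -
    have "commutator_subgroup G T B \<subseteq> carrier G"
      unfolding commutator_subgroup_def
      using sub by (intro G.generate_incl) (auto simp: subset_iff)
    then have "finite (commutator_subgroup G T B)" using fin finite_subset by blast
    then show ?thesis
      using C(3) commutator_subgroup_img[OF sub(1,2)] card_image_le order_trans by metis
  qed
  ultimately show ?thesis
    using index[OF G.subgroup_self subT sub(1)] index[OF K B] C iso(2) B
      subgroup_img_is_subgroup[OF B(1)] by auto
qed

text \<open>Being injective, \<open>h\<close> reflects commutation as well as preserving it, so
  \<open>map_prod h h\<close> matches the commuting pairs bijectively.\<close>

lemma (in group_hom) commuting_prob_img:
  assumes iso: "inj_on h (carrier G)" "h ` carrier G = carrier H" and K: "K \<subseteq> carrier G"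
  shows "commuting_prob H (h ` K) = commuting_prob G K"
proof -
  let ?P = "{(x, y). x \<in> K \<and> y \<in> carrier G \<and> x \<otimes> y = y \<otimes> x}"
  have eq: "h x \<otimes>\<^bsub>H\<^esub> h y = h y \<otimes>\<^bsub>H\<^esub> h x \<longleftrightarrow> x \<otimes> y = y \<otimes> x"
    if "x \<in> carrier G" "y \<in> carrier G" for x y
    using that inj_on_eq_iff[OF iso(1), of "x \<otimes> y" "y \<otimes> x"] by simp
  have "{(x, y). x \<in> h ` K \<and> y \<in> carrier H \<and> x \<otimes>\<^bsub>H\<^esub> y = y \<otimes>\<^bsub>H\<^esub> x} = map_prod h h ` ?P"
    unfolding iso(2) [symmetric] using K eq by (auto simp: image_iff subset_iff)
  moreover have "inj_on (map_prod h h) ?P"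
    using iso(1) K by (auto simp: inj_on_def subset_iff)
  moreover have "card (h ` K) = card K" "order H = order G"
    using iso K by (metis card_image inj_on_subset, metis card_image order_def)
  ultimately show ?thesis
    by (simp add: commuting_prob_def card_image)
qed

text \<open>An injection of the carrier into the natural numbers carries the group structure along.
  This makes a bound for groups on \<open>nat\<close> available on every type.\<close>

lemma finite_group_iso_nat:
  fixes G :: "('a, 'b) monoid_scheme" (structure)
  assumes "group G" "finite (carrier G)"
  obtains N :: "nat monoid" and h
  where "group N" "group_hom N G h" "inj_on h (carrier N)" "h ` carrier N = carrier G"
    "finite (carrier N)"
proof -
  interpret group G by fact
  obtain f :: "'a \<Rightarrow> nat" where f: "inj_on f (carrier G)"
    using assms(2) finite_imp_inj_to_nat_seg by blast
  define h where "h = inv_into (carrier G) f"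
  have hf [simp]: "h (f x) = x" if "x \<in> carrier G" for x
    using f that by (simp add: h_def)
  define N :: "nat monoid" where
    "N = \<lparr>carrier = f ` carrier G, monoid.mult = (\<lambda>x y. f (h x \<otimes> h y)), one = f \<one>\<rparr>"
  have N: "group N"
  proof (rule groupI)
    fix x assume "x \<in> carrier N"
    then show "\<exists>y\<in>carrier N. y \<otimes>\<^bsub>N\<^esub> x = \<one>\<^bsub>N\<^esub>"
      by (auto simp: N_def intro!: bexI[of _ "inv _"])
  qed (auto simp: N_def m_assoc)
  moreover have "h \<in> hom N G"
    by (auto simp: hom_def N_def)
  then have "group_hom N G h"
    using N assms(1) by (simp add: group_hom_def group_hom_axioms_def)
  moreover have "inj_on h (carrier N)" "h ` carrier N = carrier G" "finite (carrier N)"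
    using assms(2) by (auto simp: N_def inj_on_def image_image)
  ultimately show thesis by (rule that)
qed

(* C must not depend on the type of the group elements, and HOL cannot quantify over types inside
   the scope of C. So C is obtained for the finite groups on natural numbers, and every
   such C is asserted to work for finite groups on an arbitrary type 'a as well. *)
theorem proposition1p2:
  fixes \<epsilon> :: real
  assumes "\<epsilon> > 0"
  shows "(\<exists>C :: nat.
           (\<forall>(G :: nat monoid) K.
              group G \<and> finite (carrier G) \<and> subgroup K G \<and> commuting_prob G K \<ge> \<epsilon> \<longrightarrow>
              (\<exists>T B. T \<lhd> G \<and> subgroup B G \<and> B \<subseteq> K \<and>
                 subgroup_index G (carrier G) T \<le> C \<and>
                 subgroup_index G K B \<le> C \<and>
                 card (commutator_subgroup G T B) \<le> C)))
       \<and> (\<forall>C :: nat.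
           (\<forall>(G :: nat monoid) K.
              group G \<and> finite (carrier G) \<and> subgroup K G \<and> commuting_prob G K \<ge> \<epsilon> \<longrightarrow>
              (\<exists>T B. T \<lhd> G \<and> subgroup B G \<and> B \<subseteq> K \<and>
                 subgroup_index G (carrier G) T \<le> C \<and>
                 subgroup_index G K B \<le> C \<and>
                 card (commutator_subgroup G T B) \<le> C)) \<longrightarrow>
           (\<forall>(G :: ('a, 'b) monoid_scheme) K.
              group G \<and> finite (carrier G) \<and> subgroup K G \<and> commuting_prob G K \<ge> \<epsilon> \<longrightarrow>
              (\<exists>T B. T \<lhd> G \<and> subgroup B G \<and> B \<subseteq> K \<and>
                 subgroup_index G (carrier G) T \<le> C \<and>
                 subgroup_index G K B \<le> C \<and>
                 card (commutator_subgroup G T B) \<le> C)))"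
proof (intro conjI allI impI)
  \<comment> \<open>The least natural number with \<open>k * \<epsilon> \<ge> 2\<close>.\<close>
  define k where "k = nat \<lceil>2 / \<epsilon>\<rceil>"
  have pos: "2 / \<epsilon> > 0" using assms by simp
  have le: "2 / \<epsilon> \<le> k" unfolding k_def by linarith
  then have "real k > 0" using pos by linarith
  with le have k: "k * \<epsilon> \<ge> 2" "k > 0"
    using assms by (simp_all add: divide_le_eq)
  define m where "m = k ^ (2 ^ (3 * k))"
  \<comment> \<open>The sum dominates each of the three bounds and depends on
    \<open>\<epsilon>\<close> alone, through \<open>k\<close>.\<close>
  let ?C = "(k * m) ^ (k * m) + k * m ^ m + (m * m) ^ (m * m)"
  have "\<exists>T B. T \<lhd> G \<and> subgroup B G \<and> B \<subseteq> K \<and>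
          subgroup_index G (carrier G) T \<le> ?C \<and> subgroup_index G K B \<le> ?C \<and>
          card (commutator_subgroup G T B) \<le> ?C"
    if "group G" "finite (carrier G)" "subgroup K G" "commuting_prob G K \<ge> \<epsilon>"
    for G :: "nat monoid" and K
    using group.commuting_prob_bounded[OF that k, folded m_def]
    by (meson le_add1 le_add2 order_trans)
  then show "\<exists>C :: nat. \<forall>(G :: nat monoid) K.
      group G \<and> finite (carrier G) \<and> subgroup K G \<and> commuting_prob G K \<ge> \<epsilon> \<longrightarrow>
      (\<exists>T B. T \<lhd> G \<and> subgroup B G \<and> B \<subseteq> K \<and> subgroup_index G (carrier G) T \<le> C \<and>
        subgroup_index G K B \<le> C \<and> card (commutator_subgroup G T B) \<le> C)"
    by blast
next
  fix C :: nat and G :: "('a, 'b) monoid_scheme" and K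
  assume nat: "\<forall>(G :: nat monoid) K.
      group G \<and> finite (carrier G) \<and> subgroup K G \<and> commuting_prob G K \<ge> \<epsilon> \<longrightarrow>
      (\<exists>T B. T \<lhd> G \<and> subgroup B G \<and> B \<subseteq> K \<and> subgroup_index G (carrier G) T \<le> C \<and>
        subgroup_index G K B \<le> C \<and> card (commutator_subgroup G T B) \<le> C)"
    and G: "group G \<and> finite (carrier G) \<and> subgroup K G \<and> commuting_prob G K \<ge> \<epsilon>"
  obtain N :: "nat monoid" and h where N: "group N" "group_hom N G h"
    and iso: "inj_on h (carrier N)" "h ` carrier N = carrier G" and fin: "finite (carrier N)"
    using G finite_group_iso_nat[of G] by blast
  interpret group_hom N G h by fact
  \<comment> \<open>The copy of \<open>K\<close> inside \<open>N\<close>. The assumption on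
    \<open>C\<close> is applied to \<open>N\<close> and \<open>L\<close>, and \<open>h\<close>
    carries the resulting subgroups back to \<open>G\<close>.\<close>
  define L where "L = {x \<in> carrier N. h x \<in> K}"
  have subK: "K \<subseteq> carrier G" using G subgroup.subset by blast
  then have hL: "h ` L = K" using iso(2) by (auto simp: L_def image_iff subset_iff)
  have L: "subgroup L N"
  proof (rule G.subgroupI)
    show "L \<noteq> {}" using hL G subgroup.one_closed by blast
  qed (use G subgroup.m_closed subgroup.m_inv_closed in \<open>auto simp: L_def\<close>)
  have "commuting_prob N L \<ge> \<epsilon>"
    using commuting_prob_img[OF iso, of L] hL G by (simp add: L_def)
  then obtain T B where TB: "T \<lhd> N" "subgroup B N" "B \<subseteq> L"
      "subgroup_index N (carrier N) T \<le> C" "subgroup_index N L B \<le> C"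
      "card (commutator_subgroup N T B) \<le> C"
    using nat N(1) fin L by blast
  from normal_subgroup_pair_img[OF iso fin L this] hL
  show "\<exists>T B. T \<lhd> G \<and> subgroup B G \<and> B \<subseteq> K \<and> subgroup_index G (carrier G) T \<le> C \<and>
      subgroup_index G K B \<le> C \<and> card (commutator_subgroup G T B) \<le> C"
    by auto
qed

end
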